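(* For $\sigma>0$ and $c\in\mathbb{R}$, let $Z$ be a real random variable with normal distribution of mean $0$ and standard deviation $\sigma$, and let $p_c$ be the probability that the $c$-th bit of $Z$ contributes to the result accuracy, i.e. $p_c=\mathbb{P}\left(\lfloor 2^{c}|Z|\rfloor \text{ is even}\right)$. Then, when $\frac{2^{-c}}{\sigma}\to 0$, $$p_c\sim \frac{2^{-c}}{2\sigma\sqrt{2\pi}}+\frac12 .$$
   Context: $Z$ models the (absolute or relative) error of a stochastic floating-point computation. The $c$-th bit of $Z$ is said to contribute (to the accuracy of the result) when it is $0$, i.e. when $\lfloor 2^{c}|Z|\rfloor$ is even. The symbol $\sim$ denotes asymptotic equivalence: the ratio of the two sides tends to $1$ as $2^{-c}/\sigma\to 0$. *)

theory Defs
  imports "HOL-Probability.Probability" "HOL-Library.Landau_Symbols"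
begin

definition bit_contributes :: "real \<Rightarrow> real \<Rightarrow> bool" where
  "bit_contributes c z \<longleftrightarrow> even \<lfloor>2 powr c * \<bar>z\<bar>\<rfloor>"

definition contribution_prob :: "'a measure \<Rightarrow> ('a \<Rightarrow> real) \<Rightarrow> real \<Rightarrow> real" where
  "contribution_prob M Z c = measure M {\<omega> \<in> space M. bit_contributes c (Z \<omega>)}"

(* The limit is joint in (\<sigma>, c): only the quotient 2^(-c) / \<sigma> tends to 0, and \<sigma> and c
   are otherwise unconstrained apart from \<sigma> > 0. *)
definition small_ulp :: "(real \<times> real) filter" where
  "small_ulp =
     inf (filtercomap (\<lambda>(\<sigma>, c). 2 powr (-c) / \<sigma>) (nhds 0)) (principal {(\<sigma>, c). \<sigma> > 0})"

lemma eventually_small_ulp: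
  "eventually P small_ulp \<longleftrightarrow>
     (\<exists>\<delta>>0. \<forall>\<sigma>>0. \<forall>c. 2 powr (-c) / \<sigma> < \<delta> \<longrightarrow> P (\<sigma>, c))"
proof
  assume "eventually P small_ulp"
  then obtain Q where Q: "eventually Q (nhds 0)"
    and QP: "\<And>\<sigma> c. Q (2 powr (-c) / \<sigma>) \<Longrightarrow> \<sigma> > 0 \<Longrightarrow> P (\<sigma>, c)"
    unfolding small_ulp_def eventually_inf_principal eventually_filtercomap by auto
  from Q obtain \<delta> where \<delta>: "\<delta> > 0" "\<And>x. \<bar>x\<bar> < \<delta> \<Longrightarrow> Q x"
    unfolding eventually_nhds_metric by (auto simp: dist_real_def)
  have "P (\<sigma>, c)" if "\<sigma> > 0" "2 powr (-c) / \<sigma> < \<delta>" for \<sigma> c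
    using that by (intro QP \<delta>(2)) auto
  with \<delta>(1) show "\<exists>\<delta>>0. \<forall>\<sigma>>0. \<forall>c. 2 powr (-c) / \<sigma> < \<delta> \<longrightarrow> P (\<sigma>, c)"
    by blast
next
  assume "\<exists>\<delta>>0. \<forall>\<sigma>>0. \<forall>c. 2 powr (-c) / \<sigma> < \<delta> \<longrightarrow> P (\<sigma>, c)"
  then obtain \<delta> where \<delta>: "\<delta> > 0"
    "\<And>\<sigma> c. \<sigma> > 0 \<Longrightarrow> 2 powr (-c) / \<sigma> < \<delta> \<Longrightarrow> P (\<sigma>, c)"
    by blast
  have "eventually (\<lambda>x::real. x < \<delta>) (nhds 0)"
    using \<delta>(1) by (rule eventually_nhds_in_open[of "{..<\<delta>}" 0, simplified])
  then show "eventually P small_ulp"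
    unfolding small_ulp_def eventually_inf_principal eventually_filtercomap
    using \<delta>(2) by (intro exI[of _ "\<lambda>x. x < \<delta>"]) auto
qed

end

theory Submission
  imports Defs
begin

text \<open>
  Write \<open>h = 2 powr (-c)\<close>, so that the bit in question is the parity of \<open>\<lfloor>\<bar>Z\<bar> / h\<rfloor>\<close>. The cells
  \<open>[k h, (k + 1) h)\<close> of the half-line are alternately even and odd, and translation by \<open>h\<close> carries
  each cell to the next one. The density of \<open>\<bar>Z\<bar>\<close> decreases on the half-line, so translation
  to the right can only lose probability (\<open>prob_shift_le\<close>). Applied to the even cells, this says that
  even is at least as likely as odd. Applied to the odd cells, whose translates are all the even
  cells except the first, it says that even exceeds odd by at most the probability of the first cell,
  which is at most \<open>h\<close> times the maximum \<open>2 / (\<sigma> * sqrt (2 * pi))\<close> of the density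
  of \<open>\<bar>Z\<bar>\<close>. Since the two probabilities sum to \<open>1\<close>, this gives
  \<open>1/2 \<le> p \<le> 1/2 + h / (\<sigma> * sqrt (2 * pi))\<close> (\<open>contribution_prob_bounds\<close>).

  The asymptotic expression in the theorem is the midpoint of this interval. The width of the interval
  tends to \<open>0\<close> with \<open>h / \<sigma>\<close>, whereas its left end stays at \<open>1/2\<close>, so the ratio tends to \<open>1\<close>.
\<close>

lemma (in prob_space) prob_shift_le:
  fixes g :: "real \<Rightarrow> ennreal"
  assumes X: "distributed M lborel X g"
    and anti: "\<And>x y. 0 \<le> x \<Longrightarrow> x \<le> y \<Longrightarrow> g y \<le> g x"
    and h: "0 \<le> h" and S: "S \<in> sets borel" "S \<subseteq> {0..}"
  shows "prob {\<omega> \<in> space M. X \<omega> - h \<in> S} \<le> prob {\<omega> \<in> space M. X \<omega> \<in> S}"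
proof -
  have [measurable]: "X \<in> borel_measurable M" "g \<in> borel_measurable borel" "S \<in> sets borel"
    using X S by (auto simp: distributed_def)
  have "emeasure M {\<omega> \<in> space M. X \<omega> - h \<in> S} = emeasure M (X -` {x. x - h \<in> S} \<inter> space M)"
    by (rule arg_cong[where f = "emeasure M"]) auto
  also have "\<dots> = (\<integral>\<^sup>+ x. g x * indicator {x. x - h \<in> S} x \<partial>lborel)"
    by (rule distributed_emeasure[OF X]) simp
  also have "\<dots> = (\<integral>\<^sup>+ x. g (h + x) * indicator S x \<partial>lborel)"
    by (subst nn_integral_real_affine[where c = 1 and t = h])
       (auto simp: indicator_def intro!: nn_integral_cong)
  also have "\<dots> \<le> (\<integral>\<^sup>+ x. g x * indicator S x \<partial>lborel)"
    using S h by (intro nn_integral_mono) (auto simp: indicator_def intro!: anti)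
  also have "\<dots> = emeasure M (X -` S \<inter> space M)"
    by (rule distributed_emeasure[OF X, symmetric]) simp
  also have "\<dots> = emeasure M {\<omega> \<in> space M. X \<omega> \<in> S}"
    by (rule arg_cong[where f = "emeasure M"]) auto
  finally show ?thesis
    by (simp add: emeasure_eq_measure)
qed

lemma floor_diff_divide_self:
  fixes x h :: real
  assumes "h > 0"
  shows "\<lfloor>(x - h) / h\<rfloor> = \<lfloor>x / h\<rfloor> - 1"
  using assms by (simp add: diff_divide_distrib)

text \<open>
  For a nonnegative variable with decreasing density, the cells of even index are favoured over those
  of odd index, but by no more than the mass of the first cell.
\<close>

lemma (in prob_space) prob_even_floor_bounds:
  fixes g :: "real \<Rightarrow> ennreal"
  assumes X: "distributed M lborel X g"
    and neg: "\<And>x. x < 0 \<Longrightarrow> g x = 0"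
    and anti: "\<And>x y. 0 \<le> x \<Longrightarrow> x \<le> y \<Longrightarrow> g y \<le> g x"
    and K: "g 0 \<le> ennreal K" "0 \<le> K" and h: "h > 0"
  shows "1 / 2 \<le> prob {\<omega> \<in> space M. even \<lfloor>X \<omega> / h\<rfloor>}"
    and "prob {\<omega> \<in> space M. even \<lfloor>X \<omega> / h\<rfloor>} \<le> 1 / 2 + K * h / 2"
proof -
  have [measurable]: "X \<in> borel_measurable M"
    using X by (auto simp: distributed_def)
  define E where "E = {x::real. 0 \<le> x \<and> even \<lfloor>x / h\<rfloor>}"
  define D where "D = {x::real. 0 \<le> x \<and> odd \<lfloor>x / h\<rfloor>}"
  have [measurable]: "E \<in> sets borel" "D \<in> sets borel"
    unfolding E_def D_def by measurable
  have shift_E: "x - h \<in> E \<longleftrightarrow> x \<in> D" for x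
  proof -
    have "h \<le> x" if "0 \<le> x" "odd \<lfloor>x / h\<rfloor>"
    proof (rule ccontr)
      assume "\<not> h \<le> x"
      then have "\<lfloor>x / h\<rfloor> = 0" using that h by (simp add: floor_eq_iff)
      with that show False by simp
    qed
    then show ?thesis
      using h by (auto simp: E_def D_def floor_diff_divide_self)
  qed
  have shift_D: "x - h \<in> D \<longleftrightarrow> x \<in> E \<and> h \<le> x" for x
    using h by (auto simp: E_def D_def floor_diff_divide_self)
  have prob_eq: "prob {\<omega> \<in> space M. even \<lfloor>X \<omega> / h\<rfloor>} = prob {\<omega> \<in> space M. X \<omega> \<in> E}"
    and total: "prob {\<omega> \<in> space M. X \<omega> \<in> E} + prob {\<omega> \<in> space M. X \<omega> \<in> D} = 1"
  proof -
    have "emeasure M (X -` {..<0} \<inter> space M) = (\<integral>\<^sup>+ x. g x * indicator {..<0} x \<partial>lborel)"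
      by (rule distributed_emeasure[OF X]) simp
    also have "\<dots> = (\<integral>\<^sup>+ x. 0 \<partial>(lborel :: real measure))"
      by (intro nn_integral_cong) (auto simp: indicator_def neg)
    finally have "X -` {..<0} \<inter> space M \<in> null_sets M"
      by (auto intro!: null_setsI)
    then have nonneg: "AE \<omega> in M. 0 \<le> X \<omega>"
      by (rule AE_I') auto
    show "prob {\<omega> \<in> space M. even \<lfloor>X \<omega> / h\<rfloor>} = prob {\<omega> \<in> space M. X \<omega> \<in> E}"
      by (rule prob_eq_AE) (use nonneg in \<open>auto simp: E_def\<close>)
    have "prob {\<omega> \<in> space M. X \<omega> \<in> E} + prob {\<omega> \<in> space M. X \<omega> \<in> D}
        = prob ({\<omega> \<in> space M. X \<omega> \<in> E} \<union> {\<omega> \<in> space M. X \<omega> \<in> D})"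
      by (rule finite_measure_Union[symmetric]) (auto simp: E_def D_def)
    also have "\<dots> = 1"
      by (subst prob_eq_1) (use nonneg in \<open>auto simp: E_def D_def\<close>)
    finally show "prob {\<omega> \<in> space M. X \<omega> \<in> E} + prob {\<omega> \<in> space M. X \<omega> \<in> D} = 1" .
  qed
  have sub: "E \<subseteq> {0..}" "D \<subseteq> {0..}"
    by (auto simp: E_def D_def)
  have le: "prob {\<omega> \<in> space M. X \<omega> \<in> D} \<le> prob {\<omega> \<in> space M. X \<omega> \<in> E}"
    using prob_shift_le[OF X anti, of h E] h sub by (simp add: shift_E)
  have first_cell: "prob {\<omega> \<in> space M. X \<omega> \<in> {0..<h}} \<le> K * h"
  proof -
    have "emeasure M {\<omega> \<in> space M. X \<omega> \<in> {0..<h}} = emeasure M (X -` {0..<h} \<inter> space M)"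
      by (rule arg_cong[where f = "emeasure M"]) auto
    also have "\<dots> = (\<integral>\<^sup>+ x. g x * indicator {0..<h} x \<partial>lborel)"
      by (rule distributed_emeasure[OF X]) simp
    also have "\<dots> \<le> (\<integral>\<^sup>+ x. ennreal K * indicator {0..<h} x \<partial>lborel)"
      using K anti[of 0] by (intro nn_integral_mono) (auto simp: indicator_def intro: order_trans)
    also have "\<dots> = ennreal (K * h)"
      using h K by (simp add: nn_integral_cmult_indicator ennreal_mult)
    finally show ?thesis
      using h K by (simp add: emeasure_eq_measure)
  qed
  have "prob {\<omega> \<in> space M. X \<omega> \<in> E}
      \<le> prob ({\<omega> \<in> space M. X \<omega> \<in> {0..<h}} \<union> {\<omega> \<in> space M. X \<omega> - h \<in> D})"
    by (rule finite_measure_mono) (auto simp: shift_D E_def)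
  also have "\<dots> \<le> prob {\<omega> \<in> space M. X \<omega> \<in> {0..<h}} + prob {\<omega> \<in> space M. X \<omega> - h \<in> D}"
    by (rule measure_Un_le) auto
  also have "\<dots> \<le> K * h + prob {\<omega> \<in> space M. X \<omega> \<in> D}"
    using first_cell prob_shift_le[OF X anti, of h D] h sub by simp
  finally have ge: "prob {\<omega> \<in> space M. X \<omega> \<in> E} \<le> K * h + prob {\<omega> \<in> space M. X \<omega> \<in> D}" .
  show "1 / 2 \<le> prob {\<omega> \<in> space M. even \<lfloor>X \<omega> / h\<rfloor>}"
    using total le unfolding prob_eq by simp
  show "prob {\<omega> \<in> space M. even \<lfloor>X \<omega> / h\<rfloor>} \<le> 1 / 2 + K * h / 2"
    using total ge unfolding prob_eq by simp
qed

text \<open>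
  Folding at the origin doubles a symmetric density on the half-line; the origin itself, the only
  point not hit twice, is a null set.
\<close>

lemma distributed_abs:
  fixes f :: "real \<Rightarrow> ennreal"
  assumes Z: "distributed M lborel Z f" and sym: "\<And>x. f (- x) = f x"
  shows "distributed M lborel (\<lambda>\<omega>. \<bar>Z \<omega>\<bar>) (\<lambda>x. 2 * f x * indicator {0..} x)"
proof -
  have [measurable]: "Z \<in> borel_measurable M" "f \<in> borel_measurable borel"
    using Z by (auto simp: distributed_def)
  have "distr M lborel (\<lambda>\<omega>. \<bar>Z \<omega>\<bar>) = density lborel (\<lambda>x. 2 * f x * indicator {0..} x)"
  proof (rule measure_eqI)
    fix A assume "A \<in> sets (distr M lborel (\<lambda>\<omega>. \<bar>Z \<omega>\<bar>))"
    then have [measurable]: "A \<in> sets borel" by simp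
    let ?I = "\<integral>\<^sup>+ x. f x * indicator (A \<inter> {0..}) x \<partial>lborel"
    have "emeasure (distr M lborel (\<lambda>\<omega>. \<bar>Z \<omega>\<bar>)) A = emeasure M ((\<lambda>\<omega>. \<bar>Z \<omega>\<bar>) -` A \<inter> space M)"
      by (subst emeasure_distr) simp_all
    also have "\<dots> = emeasure M (Z -` {x. \<bar>x\<bar> \<in> A} \<inter> space M)"
      by (rule arg_cong[where f = "emeasure M"]) auto
    also have "\<dots> = (\<integral>\<^sup>+ x. f x * indicator {x. \<bar>x\<bar> \<in> A} x \<partial>lborel)"
      by (rule distributed_emeasure[OF Z]) simp
    also have "\<dots> = (\<integral>\<^sup>+ x. f x * indicator (A \<inter> {0..}) x
                        + f (- x) * indicator (A \<inter> {0..}) (- x) \<partial>lborel)"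
      using AE_lborel_singleton[of "0::real"]
      by (intro nn_integral_cong_AE) (auto simp: indicator_def sym abs_if elim!: eventually_mono)
    also have "\<dots> = ?I + (\<integral>\<^sup>+ x. f (- x) * indicator (A \<inter> {0..}) (- x) \<partial>lborel)"
      by (rule nn_integral_add) simp_all
    also have "(\<integral>\<^sup>+ x. f (- x) * indicator (A \<inter> {0..}) (- x) \<partial>lborel) = ?I"
      using nn_integral_real_affine[of "\<lambda>x. f x * indicator (A \<inter> {0..}) x" "-1" 0] by simp
    also have "?I + ?I = 2 * ?I"
      by (simp add: mult_2)
    also have "\<dots> = (\<integral>\<^sup>+ x. 2 * (f x * indicator (A \<inter> {0..}) x) \<partial>lborel)"
      by (rule nn_integral_cmult[symmetric]) simp
    also have "\<dots> = (\<integral>\<^sup>+ x. 2 * f x * indicator {0..} x * indicator A x \<partial>lborel)"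
      by (intro nn_integral_cong) (simp add: indicator_def)
    also have "\<dots> = emeasure (density lborel (\<lambda>x. 2 * f x * indicator {0..} x)) A"
      by (subst emeasure_density) simp_all
    finally show "emeasure (distr M lborel (\<lambda>\<omega>. \<bar>Z \<omega>\<bar>)) A
        = emeasure (density lborel (\<lambda>x. 2 * f x * indicator {0..} x)) A" .
  qed simp
  then show ?thesis
    by (auto simp: distributed_def)
qed

lemma normal_density_antimono:
  assumes "0 < \<sigma>" "0 \<le> x" "x \<le> y"
  shows "normal_density 0 \<sigma> y \<le> normal_density 0 \<sigma> x"
  using assms unfolding normal_density_def
  by (intro mult_left_mono) (auto intro!: divide_right_mono power_mono)

lemma contribution_prob_bounds:
  fixes Z :: "'a \<Rightarrow> real"
  assumes "prob_space M"
    and \<sigma>: "\<sigma> > 0"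
    and Z: "distributed M lborel Z (\<lambda>x. ennreal (normal_density 0 \<sigma> x))"
  shows "1 / 2 \<le> contribution_prob M Z c"
    and "contribution_prob M Z c \<le> 1 / 2 + 2 powr (-c) / \<sigma> / sqrt (2 * pi)"
proof -
  interpret prob_space M by fact
  define g where "g = (\<lambda>x. 2 * ennreal (normal_density 0 \<sigma> x) * indicator {0..} x)"
  have X: "distributed M lborel (\<lambda>\<omega>. \<bar>Z \<omega>\<bar>) g"
    unfolding g_def by (rule distributed_abs[OF Z]) (simp add: normal_density_def)
  have neg: "g x = 0" if "x < 0" for x
    using that by (simp add: g_def)
  have anti: "g y \<le> g x" if "0 \<le> x" "x \<le> y" for x y
    using that normal_density_antimono[OF \<sigma> that]
    by (auto simp: g_def intro!: mult_left_mono ennreal_leI)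
  define K where "K = 2 / (\<sigma> * sqrt (2 * pi))"
  have "normal_density 0 \<sigma> 0 = K / 2"
    using \<sigma> by (simp add: normal_density_def K_def real_sqrt_mult)
  then have K: "g 0 \<le> ennreal K" "0 \<le> K"
    using \<sigma> by (auto simp: g_def K_def ennreal_mult simp flip: ennreal_numeral ennreal_mult)
  have prob: "contribution_prob M Z c = prob {\<omega> \<in> space M. even \<lfloor>\<bar>Z \<omega>\<bar> / 2 powr (-c)\<rfloor>}"
    by (simp add: contribution_prob_def bit_contributes_def powr_minus divide_inverse mult.commute)
  show "1 / 2 \<le> contribution_prob M Z c"
    unfolding prob by (rule prob_even_floor_bounds(1)[OF X neg anti K]) auto
  have "contribution_prob M Z c \<le> 1 / 2 + K * 2 powr (-c) / 2"
    unfolding prob by (rule prob_even_floor_bounds(2)[OF X neg anti K]) auto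
  then show "contribution_prob M Z c \<le> 1 / 2 + 2 powr (-c) / \<sigma> / sqrt (2 * pi)"
    by (simp add: K_def)
qed

theorem theorem2:
  fixes M :: "real \<Rightarrow> real \<Rightarrow> 'a measure"
    and Z :: "real \<Rightarrow> real \<Rightarrow> 'a \<Rightarrow> real"
  assumes "\<And>\<sigma> c. \<sigma> > 0 \<Longrightarrow> prob_space (M \<sigma> c)"
    and "\<And>\<sigma> c. \<sigma> > 0 \<Longrightarrow>
           distributed (M \<sigma> c) lborel (Z \<sigma> c) (\<lambda>x. ennreal (normal_density 0 \<sigma> x))"
  shows "(\<lambda>(\<sigma>, c). contribution_prob (M \<sigma> c) (Z \<sigma> c) c)
           \<sim>[small_ulp] (\<lambda>(\<sigma>, c). 2 powr (-c) / (2 * \<sigma> * sqrt (2 * pi)) + 1 / 2)"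
proof -
  let ?p = "\<lambda>(\<sigma>, c). contribution_prob (M \<sigma> c) (Z \<sigma> c) c"
  define u :: "real \<times> real \<Rightarrow> real" where "u = (\<lambda>(\<sigma>, c). 2 powr (-c) / \<sigma>)"
  have u: "(u \<longlongrightarrow> 0) small_ulp"
    unfolding small_ulp_def u_def by (rule tendsto_mono[OF inf_le1 filterlim_filtercomap])
  have pos: "eventually (\<lambda>(\<sigma>, c). \<sigma> > 0) small_ulp"
    unfolding eventually_small_ulp by (intro exI[of _ 1]) simp
  have p: "(?p \<longlongrightarrow> 1 / 2) small_ulp"
  proof (rule tendsto_sandwich)
    show "eventually (\<lambda>x. 1 / 2 \<le> ?p x) small_ulp"
      using pos
      by (rule eventually_mono) (clarify, rule contribution_prob_bounds(1)[OF assms(1) _ assms(2)])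
    show "eventually (\<lambda>x. ?p x \<le> 1 / 2 + u x / sqrt (2 * pi)) small_ulp"
      using pos unfolding u_def
      by (rule eventually_mono) (clarify, rule contribution_prob_bounds(2)[OF assms(1) _ assms(2)])
    show "((\<lambda>x. 1 / 2 + u x / sqrt (2 * pi)) \<longlongrightarrow> 1 / 2) small_ulp"
      by (rule tendsto_eq_intros u refl | simp)+
  qed simp
  have r: "((\<lambda>x. u x / (2 * sqrt (2 * pi)) + 1 / 2) \<longlongrightarrow> 1 / 2) small_ulp"
    by (rule tendsto_eq_intros u refl | simp)+
  have r_eq: "(\<lambda>(\<sigma>, c). 2 powr (-c) / (2 * \<sigma> * sqrt (2 * pi)) + 1 / 2)
      = (\<lambda>x. u x / (2 * sqrt (2 * pi)) + 1 / 2)"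
    by (auto simp: u_def mult_ac)
  show ?thesis
    unfolding r_eq using tendsto_divide[OF p r] by (intro asymp_equivI') simp
qed

end
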